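(* Let $\Omega\subset\mathbb{R}^N$ be an open connected set with Lipschitz boundary. Then for any measurable set $E\subset\mathbb{R}^N$ such that $P^\gamma_{s_0}(E;\Omega)<\infty$ for some $s_0\in(0,1)$, the limit $$\mu(E):=\lim_{s\to 0^+}sP^\gamma_s(E;\Omega)$$ exists and $$\mu(E)=2\left(\gamma(E)\gamma(\Omega\setminus E)+\gamma(E\cap\Omega)\gamma(E^c\cap\Omega^c)\right).$$
   Context: $N\in\mathbb{N}$, $N\ge 1$. $\gamma$ denotes the standard Gaussian probability measure on $\mathbb{R}^N$, $d\gamma(x)=(2\pi)^{-N/2}e^{-|x|^2/2}\,dx$. "Measurable" means Lebesgue measurable and $A^c=\mathbb{R}^N\setminus A$. For $t>0$ and $x,y\in\mathbb{R}^N$ the Mehler kernel is $$M_t(x,y):=\frac{1}{(1-e^{-2t})^{N/2}}\exp\left(-\frac{e^{-2t}|x|^2-2e^{-t}x\cdot y+e^{-2t}|y|^2}{2(1-e^{-2t})}\right),$$ and for $\sigma>0$ $$K_\sigma(x,y):=\int_0^\infty\frac{M_t(x,y)}{t^{\frac{\sigma}{2}+1}}\,dt.$$ For $s\in(0,1)$ and a measurable set $E\subset\mathbb{R}^N$, the fractional Gaussian $s$-perimeter of $E$ in $\Omega$ is the (possibly infinite) quantity $$P^\gamma_s(E;\Omega):=\int_{E\cap\Omega}d\gamma(x)\int_{E^c\cap\Omega}K_s(x,y)\,d\gamma(y)+\int_{E\cap\Omega}d\gamma(x)\int_{E^c\cap\Omega^c}K_s(x,y)\,d\gamma(y)+\int_{E\cap\Omega^c}d\gamma(x)\int_{E^c\cap\Omega}K_s(x,y)\,d\gamma(y).$$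 *)

theory Defs
  imports "HOL-Analysis.Analysis"
begin

text \<open>The ambient space is \<open>real ^ 'n\<close>, so that \<open>N = CARD('n) \<ge> 1\<close>. The Gaussian measure is built over
  the completed measure \<open>lebesgue\<close>: all Lebesgue measurable sets are \<open>gauss\<close>-measurable.\<close>

definition gauss :: "(real ^ 'n) measure" where
  "gauss = density lebesgue
     (\<lambda>x. ennreal ((2 * pi) powr (- (real CARD('n) / 2)) * exp (- (norm x)\<^sup>2 / 2)))"

definition mehler :: "real \<Rightarrow> real ^ 'n \<Rightarrow> real ^ 'n \<Rightarrow> real" where
  "mehler t x y =
     1 / (1 - exp (- 2 * t)) powr (real CARD('n) / 2) *
     exp (- (exp (- 2 * t) * (norm x)\<^sup>2 - 2 * exp (- t) * (x \<bullet> y) + exp (- 2 * t) * (norm y)\<^sup>2)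
          / (2 * (1 - exp (- 2 * t))))"

text \<open>The kernel is infinite on the diagonal, hence extended-valued.\<close>

definition frac_kernel :: "real \<Rightarrow> real ^ 'n \<Rightarrow> real ^ 'n \<Rightarrow> ennreal" where
  "frac_kernel \<sigma> x y = (\<integral>\<^sup>+t\<in>{0<..}. ennreal (mehler t x y / t powr (\<sigma> / 2 + 1)) \<partial>lborel)"

definition frac_perimeter :: "real \<Rightarrow> (real ^ 'n) set \<Rightarrow> (real ^ 'n) set \<Rightarrow> ennreal" where
  "frac_perimeter s E \<Omega> =
     (\<integral>\<^sup>+x\<in>E \<inter> \<Omega>. (\<integral>\<^sup>+y\<in>(- E) \<inter> \<Omega>. frac_kernel s x y \<partial>gauss) \<partial>gauss) +
     (\<integral>\<^sup>+x\<in>E \<inter> \<Omega>. (\<integral>\<^sup>+y\<in>(- E) \<inter> (- \<Omega>). frac_kernel s x y \<partial>gauss) \<partial>gauss) +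
     (\<integral>\<^sup>+x\<in>E \<inter> (- \<Omega>). (\<integral>\<^sup>+y\<in>(- E) \<inter> \<Omega>. frac_kernel s x y \<partial>gauss) \<partial>gauss)"

text \<open>Near every boundary point, \<open>\<Omega>\<close> is the strict epigraph, in some unit direction \<open>\<nu>\<close>, of a Lipschitz
  function \<open>g\<close> on the hyperplane orthogonal to \<open>\<nu>\<close> (this replaces a rigid change of coordinates
  \<open>x = (x', x\<^sub>N)\<close> with \<open>\<nu> = e\<^sub>N\<close>). No boundedness of \<open>\<Omega>\<close> and no uniformity in \<open>p\<close> is required.\<close>

definition lipschitz_boundary :: "(real ^ 'n) set \<Rightarrow> bool" where
  "lipschitz_boundary \<Omega> \<longleftrightarrow>
     (\<forall>p\<in>frontier \<Omega>. \<exists>r>0. \<exists>\<nu> g L. norm \<nu> = 1 \<and> L-lipschitz_on {z. z \<bullet> \<nu> = 0} g \<and>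
        \<Omega> \<inter> ball p r = {x \<in> ball p r. g (x - (x \<bullet> \<nu>) *\<^sub>R \<nu>) < x \<bullet> \<nu>})"

end

theory Submission
  imports Defs "HOL-Probability.Distributions"
begin

text \<open>The mechanism is that \<open>s K\<^sub>s(x, y)\<close> forgets everything about the Mehler kernel except its value at
  infinite time. On \<open>{T..}\<close> the measure \<open>s t powr (- s / 2 - 1) dt\<close> has mass \<open>2 T powr (- s / 2)\<close>, which tends
  to \<open>2\<close> as \<open>s \<rightarrow> 0\<close>, for every fixed \<open>T > 0\<close>: all the mass escapes to infinity. There the Mehler kernel tends to
  \<open>1\<close>, because the Ornstein-Uhlenbeck semigroup equilibrates. The contribution of bounded times is at most
  \<open>s\<close> times a constant times \<open>K\<^bsub>s0\<^esub>(x, y)\<close>, hence negligible wherever the latter is finite. So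
  \<open>s K\<^sub>s(x, y) \<rightarrow> 2\<close> pointwise (\<open>frac_kernel_tendsto\<close>).

  To integrate this over \<open>A \<times> B\<close>, split the time integral at \<open>T = 1\<close>: for small \<open>s\<close> one gets
  \<open>s K\<^sub>s(x, y) \<le> K\<^bsub>s0\<^esub>(x, y) + C exp (\<bar>x\<bar>\<^sup>2 / 6) exp (\<bar>y\<bar>\<^sup>2 / 6)\<close> (\<open>frac_kernel_dominated\<close>). The first
  summand is integrable over \<open>A \<times> B\<close> when the interaction of order \<open>s0\<close> is finite, the second because
  \<open>1 / 6 < 1 / 2\<close>. Dominated convergence, first in \<open>y\<close> and then in \<open>x\<close>, shows that \<open>s\<close> times the interaction
  of \<open>A\<close> and \<open>B\<close> tends to \<open>2 \<gamma>(A) \<gamma>(B)\<close> (\<open>interaction_tendsto\<close>). Adding the three interactions that make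
  up the perimeter and splitting \<open>\<gamma>(E)\<close> along \<open>\<Omega>\<close> gives the formula for the limit.\<close>

section \<open>Integrals against the measure t powr (-s/2-1) dt as s tends to 0\<close>

definition subord :: "real \<Rightarrow> (real \<Rightarrow> real) \<Rightarrow> ennreal" where
  "subord s m = (\<integral>\<^sup>+t\<in>{0<..}. ennreal (m t / t powr (s / 2 + 1)) \<partial>lborel)"

lemma frac_kernel_eq_subord: "frac_kernel s x y = subord s (\<lambda>t. mehler t x y)"
  by (simp add: frac_kernel_def subord_def)

lemma nn_integral_powr_tail:
  fixes s T c :: real
  assumes "0 < s" "0 < T" "0 \<le> c"
  shows "ennreal s * (\<integral>\<^sup>+t\<in>{T..}. ennreal (c / t powr (s / 2 + 1)) \<partial>lborel) =
         ennreal (2 * c * T powr (- (s / 2)))"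
proof -
  have "(\<integral>\<^sup>+t\<in>{T..}. ennreal (c / t powr (s / 2 + 1)) \<partial>lborel) =
        ennreal (0 - (- (2 * c / s) * T powr (- (s / 2))))"
  proof (rule nn_integral_FTC_atLeast)
    show "((\<lambda>t. - (2 * c / s) * t powr (- (s / 2))) has_real_derivative c / x powr (s / 2 + 1)) (at x)"
      if "T \<le> x" for x
    proof -
      have "((\<lambda>t. - (2 * c / s) * t powr (- (s / 2))) has_real_derivative
             - (2 * c / s) * (- (s / 2) * x powr (- (s / 2) - 1))) (at x)"
        using that assms by (auto intro!: derivative_eq_intros)
      also have "- (2 * c / s) * (- (s / 2) * x powr (- (s / 2) - 1)) = c * x powr (- (s / 2 + 1))"
        using assms by simp
      also have "\<dots> = c / x powr (s / 2 + 1)"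
        by (simp only: powr_minus_divide) simp
      finally show ?thesis .
    qed
    have "((\<lambda>t. t powr (- (s / 2))) \<longlongrightarrow> 0) at_top"
      using assms by (intro tendsto_neg_powr filterlim_ident) auto
    from tendsto_mult_right_zero[OF this, of "- (2 * c / s)"]
    show "((\<lambda>t. - (2 * c / s) * t powr (- (s / 2))) \<longlongrightarrow> 0) at_top"
      by simp
  qed (use assms in auto)
  then show ?thesis
    using assms by (simp add: ennreal_mult[symmetric])
qed

text \<open>For \<open>t < T\<close> the weight of order \<open>s\<close> is at most \<open>T powr (s0 / 2)\<close> times the weight of order \<open>s0\<close>, since
  \<open>s \<le> s0\<close>; for \<open>t \<ge> T\<close> the function \<open>m\<close> is replaced by the constant \<open>D\<close>. The bound serves twice: with \<open>T\<close> large
  and \<open>D\<close> close to \<open>1\<close> for the pointwise limit, with \<open>T = 1\<close> for the domination.\<close>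

lemma subord_upper_bound:
  fixes m :: "real \<Rightarrow> real"
  assumes [measurable]: "m \<in> borel_measurable borel"
    and nonneg: "\<And>t. 0 < t \<Longrightarrow> 0 \<le> m t"
    and s: "0 < s" "s \<le> s0" and T: "1 \<le> T"
    and tail: "\<And>t. T \<le> t \<Longrightarrow> m t \<le> D" and D: "0 \<le> D"
  shows "ennreal s * subord s m \<le>
         ennreal (s * T powr (s0 / 2)) * subord s0 m + ennreal (2 * D * T powr (- (s / 2)))"
proof -
  let ?w = "\<lambda>r t. ennreal (m t / t powr (r / 2 + 1))"
  have "subord s m \<le> (\<integral>\<^sup>+t. ennreal (T powr (s0 / 2)) * (?w s0 t * indicator {0<..} t)
      + ennreal (D / t powr (s / 2 + 1)) * indicator {T..} t \<partial>lborel)"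
    unfolding subord_def
  proof (rule nn_integral_mono)
    fix t :: real
    consider "t \<le> 0" | "0 < t" "t < T" | "T \<le> t" by linarith
    then show "?w s t * indicator {0<..} t \<le> ennreal (T powr (s0 / 2)) * (?w s0 t * indicator {0<..} t)
      + ennreal (D / t powr (s / 2 + 1)) * indicator {T..} t"
    proof cases
      case 2
      have "t powr ((s0 - s) / 2) \<le> T powr ((s0 - s) / 2)"
        using 2 s by (intro powr_mono2) auto
      also have "\<dots> \<le> T powr (s0 / 2)"
        using s T by (intro powr_mono) auto
      finally have *: "t powr ((s0 - s) / 2) \<le> T powr (s0 / 2)" .
      have "t powr (s0 / 2 + 1) = t powr ((s0 - s) / 2) * t powr (s / 2 + 1)"
        by (simp add: diff_divide_distrib flip: powr_add)
      then have "m t / t powr (s / 2 + 1) = t powr ((s0 - s) / 2) * (m t / t powr (s0 / 2 + 1))"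
        using 2 by simp
      also have "\<dots> \<le> T powr (s0 / 2) * (m t / t powr (s0 / 2 + 1))"
        using 2 nonneg[of t] * by (intro mult_right_mono) auto
      finally show ?thesis
        using 2 nonneg[of t] by (simp add: ennreal_mult[symmetric] ennreal_leI)
    next
      case 3
      then have "?w s t \<le> ennreal (D / t powr (s / 2 + 1))"
        using tail[of t] by (intro ennreal_leI divide_right_mono) auto
      then show ?thesis
        using 3 T by (simp add: add_increasing)
    qed (use T in auto)
  qed
  also have "\<dots> = ennreal (T powr (s0 / 2)) * subord s0 m
      + (\<integral>\<^sup>+t\<in>{T..}. ennreal (D / t powr (s / 2 + 1)) \<partial>lborel)"
    by (subst nn_integral_add) (auto simp: nn_integral_cmult subord_def)
  finally have "ennreal s * subord s m \<le> ennreal s * (ennreal (T powr (s0 / 2)) * subord s0 m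
      + (\<integral>\<^sup>+t\<in>{T..}. ennreal (D / t powr (s / 2 + 1)) \<partial>lborel))"
    by (rule mult_left_mono) simp
  also have "\<dots> = ennreal (s * T powr (s0 / 2)) * subord s0 m + ennreal (2 * D * T powr (- (s / 2)))"
    using s T D by (simp add: distrib_left nn_integral_powr_tail ennreal_mult mult.assoc)
  finally show ?thesis .
qed

lemma subord_lower_bound:
  assumes s: "0 < s" and T: "0 < T" and tail: "\<And>t. T \<le> t \<Longrightarrow> c \<le> m t" and c: "0 \<le> c"
  shows "ennreal (2 * c * T powr (- (s / 2))) \<le> ennreal s * subord s m"
proof -
  have "(\<integral>\<^sup>+t\<in>{T..}. ennreal (c / t powr (s / 2 + 1)) \<partial>lborel) \<le> subord s m"
    unfolding subord_def
    using T tail by (intro nn_integral_mono) (auto intro!: ennreal_leI divide_right_mono split: split_indicator)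
  then have "ennreal s * (\<integral>\<^sup>+t\<in>{T..}. ennreal (c / t powr (s / 2 + 1)) \<partial>lborel) \<le> ennreal s * subord s m"
    by (rule mult_left_mono) simp
  then show ?thesis
    using s T c by (simp add: nn_integral_powr_tail)
qed

text \<open>As \<open>s \<rightarrow> 0\<close> with \<open>T\<close> fixed, the bound of \<open>subord_lower_bound\<close> tends to \<open>2 c\<close> and that of
  \<open>subord_upper_bound\<close> to \<open>2 D\<close>; a large \<open>T\<close>
  allows \<open>c\<close> and \<open>D\<close> arbitrarily close to \<open>1\<close>.\<close>

lemma subord_tendsto:
  fixes m :: "real \<Rightarrow> real"
  assumes meas: "m \<in> borel_measurable borel"
    and nonneg: "\<And>t. 0 < t \<Longrightarrow> 0 \<le> m t"
    and lim: "(m \<longlongrightarrow> 1) at_top"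
    and s0: "0 < s0" and fin: "subord s0 m < \<infinity>"
  shows "((\<lambda>s. ennreal s * subord s m) \<longlongrightarrow> 2) (at_right 0)"
proof (rule order_tendstoI)
  fix a :: ennreal assume a: "a < 2"
  then obtain a' where a': "a = ennreal a'" "0 \<le> a'" "a' < 2"
    by (cases a) (auto simp: ennreal_less_iff simp flip: ennreal_numeral)
  define c where "c = (a' / 2 + 1) / 2"
  have c: "0 \<le> c" "a' < 2 * c" "c < 1" using a' by (auto simp: c_def)
  obtain T0 where T0: "\<And>t. T0 \<le> t \<Longrightarrow> c < m t"
    using order_tendstoD(1)[OF lim c(3)] by (auto simp: eventually_at_top_linorder)
  define T where "T = max 1 T0"
  have T: "1 \<le> T" "T0 \<le> T" by (auto simp: T_def)
  have "((\<lambda>s. 2 * c * T powr (- (s / 2))) \<longlongrightarrow> 2 * c * T powr (- (0 / 2))) (at_right 0)"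
    using T by (intro tendsto_intros) auto
  then have "((\<lambda>s. 2 * c * T powr (- (s / 2))) \<longlongrightarrow> 2 * c) (at_right 0)"
    using T by simp
  from order_tendstoD(1)[OF this c(2)] eventually_at_right_less[of 0]
  show "\<forall>\<^sub>F s in at_right 0. a < ennreal s * subord s m"
  proof eventually_elim
    case (elim s)
    have "a < ennreal (2 * c * T powr (- (s / 2)))"
      using elim a' by (simp add: ennreal_lessI)
    also have "\<dots> \<le> ennreal s * subord s m"
      using elim T T0 c by (intro subord_lower_bound) (auto simp: less_imp_le)
    finally show ?case .
  qed
next
  fix a :: ennreal assume "2 < a"
  then obtain b' where b': "2 < b'" "b' < a" using dense by blast
  then obtain b where b: "2 < b" "ennreal b < a"
    by (cases b') (auto simp: ennreal_less_iff simp flip: ennreal_numeral)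
  define c where "c = (b / 2 + 1) / 2"
  have c: "0 \<le> c" "2 * c < b" "1 < c" using b by (auto simp: c_def)
  obtain T0 where T0: "\<And>t. T0 \<le> t \<Longrightarrow> m t < c"
    using order_tendstoD(2)[OF lim c(3)] by (auto simp: eventually_at_top_linorder)
  define T where "T = max 1 T0"
  have T: "1 \<le> T" "T0 \<le> T" by (auto simp: T_def)
  obtain k where k: "subord s0 m = ennreal k" "0 \<le> k"
    using fin by (cases "subord s0 m") auto
  have "((\<lambda>s. s * T powr (s0 / 2) * k + 2 * c * T powr (- (s / 2))) \<longlongrightarrow>
      0 * T powr (s0 / 2) * k + 2 * c * T powr (- (0 / 2))) (at_right 0)"
    using T by (intro tendsto_intros) auto
  then have "((\<lambda>s. s * T powr (s0 / 2) * k + 2 * c * T powr (- (s / 2))) \<longlongrightarrow> 2 * c) (at_right 0)"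
    using T by simp
  from order_tendstoD(2)[OF this c(2)] eventually_at_right_less[of 0]
    eventually_at_right_real[OF s0]
  show "\<forall>\<^sub>F s in at_right 0. ennreal s * subord s m < a"
  proof eventually_elim
    case (elim s)
    have "ennreal s * subord s m \<le>
        ennreal (s * T powr (s0 / 2)) * subord s0 m + ennreal (2 * c * T powr (- (s / 2)))"
      using elim T T0 c meas nonneg by (intro subord_upper_bound) (auto simp: less_imp_le)
    also have "\<dots> = ennreal (s * T powr (s0 / 2) * k + 2 * c * T powr (- (s / 2)))"
      using elim k c by (simp add: ennreal_mult ennreal_plus)
    also have "\<dots> \<le> ennreal b"
      using elim by (intro ennreal_leI) auto
    finally show ?case using b by simp
  qed
qed

section \<open>The Mehler kernel at large times\<close>

lemma mehler_nonneg: "0 \<le> mehler t x y"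
  by (simp add: mehler_def)

lemma mehler_measurable [measurable (raw)]:
  assumes [measurable]: "f \<in> borel_measurable M" "g \<in> borel_measurable M" "h \<in> borel_measurable M"
  shows "(\<lambda>w. mehler (f w) (g w) (h w)) \<in> borel_measurable M"
  unfolding mehler_def by measurable

lemma mehler_tendsto_1: "((\<lambda>t. mehler t x y) \<longlongrightarrow> 1) at_top"
proof -
  have e: "((\<lambda>t::real. exp (- a * t)) \<longlongrightarrow> 0) at_top" if "0 < a" for a
    using that by (intro filterlim_compose[OF exp_at_bot] filterlim_tendsto_neg_mult_at_bot[OF tendsto_const]
        filterlim_ident) auto
  have "((\<lambda>t. mehler t x y) \<longlongrightarrow> 1 / (1 - 0) powr (real CARD('a) / 2) *
     exp (- (0 * (norm x)\<^sup>2 - 2 * 0 * (x \<bullet> y) + 0 * (norm y)\<^sup>2) / (2 * (1 - 0)))) at_top"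
    unfolding mehler_def
    using e[of 1] e[of 2] by (intro tendsto_intros) auto
  then show ?thesis by simp
qed

text \<open>With \<open>r = exp (- t)\<close>, the inequality \<open>2 x \<bullet> y \<le> \<bar>x\<bar>\<^sup>2 + \<bar>y\<bar>\<^sup>2\<close> bounds the exponent by
  \<open>r / (2 (1 + r))\<close> times \<open>\<bar>x\<bar>\<^sup>2 + \<bar>y\<bar>\<^sup>2\<close>. For \<open>t \<ge> 1\<close> one has \<open>r \<le> 1 / 2\<close>, so this factor is at most \<open>1 / 6\<close>:
  below \<open>1 / 2\<close>, hence integrable against the Gaussian density.\<close>

lemma mehler_le:
  fixes x y :: "real ^ 'n"
  assumes "1 \<le> t"
  shows "mehler t x y \<le> 2 powr (real CARD('n) / 2) * (exp ((norm x)\<^sup>2 / 6) * exp ((norm y)\<^sup>2 / 6))"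
proof -
  define r where "r = exp (- t)"
  have "2 \<le> exp t" using assms exp_ge_add_one_self[of t] by linarith
  then have r: "0 < r" "r \<le> 1/2" by (auto simp: r_def exp_minus field_simps)
  have r2: "exp (- 2 * t) = r * r" by (simp add: r_def flip: exp_add)
  have rr: "r * r \<le> 1/2 * (1/2)" using r by (intro mult_mono) auto
  have cs: "2 * (x \<bullet> y) \<le> (norm x)\<^sup>2 + (norm y)\<^sup>2"
    using inner_ge_zero[of "x - y"] by (simp add: algebra_simps power2_norm_eq_inner inner_commute)
  have "- (r * r * (norm x)\<^sup>2 - 2 * r * (x \<bullet> y) + r * r * (norm y)\<^sup>2)
      \<le> r * (1 - r) * ((norm x)\<^sup>2 + (norm y)\<^sup>2)"
    using mult_left_mono[OF cs, of r] r by (simp add: algebra_simps)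
  then have "- (r * r * (norm x)\<^sup>2 - 2 * r * (x \<bullet> y) + r * r * (norm y)\<^sup>2) / (2 * (1 - r * r))
      \<le> r * (1 - r) * ((norm x)\<^sup>2 + (norm y)\<^sup>2) / (2 * (1 - r * r))"
    using rr by (intro divide_right_mono) auto
  also have "\<dots> = (r * (1 - r) / (2 * (1 - r * r))) * ((norm x)\<^sup>2 + (norm y)\<^sup>2)" by simp
  also have "r * (1 - r) / (2 * (1 - r * r)) = r / (2 * (1 + r))"
  proof -
    have "1 - r * r = (1 - r) * (1 + r)" by (simp add: algebra_simps)
    then show ?thesis using r by simp
  qed
  also have "r / (2 * (1 + r)) * ((norm x)\<^sup>2 + (norm y)\<^sup>2) \<le> 1 / 6 * ((norm x)\<^sup>2 + (norm y)\<^sup>2)"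
    using r by (intro mult_right_mono) (auto simp: field_simps)
  finally have E: "exp (- (r * r * (norm x)\<^sup>2 - 2 * r * (x \<bullet> y) + r * r * (norm y)\<^sup>2) / (2 * (1 - r * r)))
      \<le> exp ((norm x)\<^sup>2 / 6) * exp ((norm y)\<^sup>2 / 6)"
    by (simp add: add_divide_distrib flip: exp_add)
  have "1 / (1 - r * r) powr (real CARD('n) / 2) = (1 / (1 - r * r)) powr (real CARD('n) / 2)"
    using rr by (simp add: powr_divide)
  also have "\<dots> \<le> 2 powr (real CARD('n) / 2)"
    using rr by (intro powr_mono2) (auto simp: field_simps)
  finally show ?thesis
    unfolding mehler_def r2 r_def[symmetric] using E by (intro mult_mono) auto
qed

section \<open>Integrability with respect to the Gaussian measure\<close>

lemma sets_gauss [simp, measurable_cong]: "sets gauss = sets lebesgue"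
  by (simp add: gauss_def)

lemma space_gauss [simp]: "space gauss = UNIV"
  by (simp add: gauss_def)

lemma measurable_gauss_borel [measurable]: "(\<lambda>x. x) \<in> gauss \<rightarrow>\<^sub>M borel"
proof -
  have "(\<lambda>x. x) \<in> lebesgue \<rightarrow>\<^sub>M borel"
    by (intro measurable_completion) simp
  then show ?thesis by (simp cong: measurable_cong_sets)
qed

lemma nn_integral_exp_neg_norm_square:
  assumes "0 < a"
  shows "(\<integral>\<^sup>+x. ennreal (exp (- a * (norm x)\<^sup>2)) \<partial>(lborel :: (real ^ 'n) measure)) < \<infinity>"
proof -
  (* The standard deviation for which the normal density is proportional to exp (- a t^2). *)
  define \<sigma> where "\<sigma> = sqrt (1 / (2 * a))"
  have \<sigma>: "0 < \<sigma>" "\<sigma>\<^sup>2 = 1 / (2 * a)" using assms by (auto simp: \<sigma>_def)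
  have 1: "exp (- a * t\<^sup>2) = sqrt (2 * pi * \<sigma>\<^sup>2) * normal_density 0 \<sigma> t" for t
    using \<sigma> assms by (simp add: normal_density_def)
  have "integrable lborel (\<lambda>t. exp (- a * t\<^sup>2))"
    unfolding 1 using integrable_normal_density[OF \<sigma>(1)] by (intro integrable_mult_right) auto
  then have fin: "(\<integral>\<^sup>+t. ennreal (exp (- a * t\<^sup>2)) \<partial>lborel) < \<infinity>"
    by (simp add: integrable_iff_bounded)
  have "exp (- a * (norm x)\<^sup>2) = (\<Prod>b\<in>Basis. exp (- a * (x \<bullet> b)\<^sup>2))" for x :: "real ^ 'n"
    unfolding power2_norm_eq_inner euclidean_inner[of x x]
    by (simp add: sum_distrib_left power2_eq_square flip: exp_sum)
  then have "(\<integral>\<^sup>+x. ennreal (exp (- a * (norm x)\<^sup>2)) \<partial>(lborel :: (real ^ 'n) measure)) =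
      (\<integral>\<^sup>+x. (\<Prod>b\<in>Basis. ennreal (exp (- a * (x \<bullet> b)\<^sup>2))) \<partial>(lborel :: (real ^ 'n) measure))"
    by (simp add: prod_ennreal)
  also have "\<dots> = (\<Prod>b\<in>(Basis :: (real ^ 'n) set). \<integral>\<^sup>+t. ennreal (exp (- a * t\<^sup>2)) \<partial>lborel)"
    by (intro nn_integral_lborel_prod) auto
  also have "\<dots> < \<infinity>"
    using fin by (simp add: ennreal_prod_eq_top less_top power_less_top_ennreal)
  finally show ?thesis .
qed

lemma nn_integral_gauss_exp_square:
  assumes "a < 1 / 2"
  shows "(\<integral>\<^sup>+x. ennreal (exp (a * (norm x)\<^sup>2)) \<partial>(gauss :: (real ^ 'n) measure)) < \<infinity>"
proof -
  define k where "k = (2 * pi) powr (- (real CARD('n) / 2))"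
  have "(\<integral>\<^sup>+x. ennreal (exp (a * (norm x)\<^sup>2)) \<partial>(gauss :: (real ^ 'n) measure)) =
     (\<integral>\<^sup>+x. ennreal (k * exp (- (norm x)\<^sup>2 / 2)) * ennreal (exp (a * (norm x)\<^sup>2)) \<partial>(lebesgue :: (real ^ 'n) measure))"
    unfolding gauss_def k_def by (intro nn_integral_density) (auto intro!: measurable_completion)
  also have "\<dots> = (\<integral>\<^sup>+x. ennreal k * ennreal (exp (- (1 / 2 - a) * (norm x)\<^sup>2)) \<partial>(lebesgue :: (real ^ 'n) measure))"
    by (intro nn_integral_cong) (simp add: k_def algebra_simps flip: ennreal_mult exp_add)
  also have "\<dots> = ennreal k * (\<integral>\<^sup>+x. ennreal (exp (- (1 / 2 - a) * (norm x)\<^sup>2)) \<partial>(lborel :: (real ^ 'n) measure))"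
    by (simp add: nn_integral_completion nn_integral_cmult)
  also have "\<dots> < \<infinity>"
    using nn_integral_exp_neg_norm_square[of "1 / 2 - a", where 'n = 'n] assms
    by (simp add: ennreal_mult_less_top)
  finally show ?thesis .
qed

lemma finite_measure_gauss: "finite_measure (gauss :: (real ^ 'n) measure)"
  using nn_integral_gauss_exp_square[of 0, where 'n = 'n] by (intro finite_measureI) simp


section \<open>Convergence of the rescaled interactions\<close>

lemma frac_kernel_measurable [measurable (raw)]:
  assumes [measurable]: "f \<in> borel_measurable M" "g \<in> borel_measurable M"
  shows "(\<lambda>w. frac_kernel s (f w) (g w)) \<in> borel_measurable M"
  unfolding frac_kernel_def by measurable

lemma frac_kernel_tendsto:
  assumes "0 < s0" "frac_kernel s0 x y < \<infinity>"
  shows "((\<lambda>s. ennreal s * frac_kernel s x y) \<longlongrightarrow> 2) (at_right 0)"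
  using assms unfolding frac_kernel_eq_subord
  by (intro subord_tendsto[where ?s0.0 = s0] mehler_nonneg mehler_tendsto_1) auto

lemma frac_kernel_dominated:
  fixes x y :: "real ^ 'n"
  assumes "0 < s" "s \<le> s0" "s \<le> 1"
  shows "ennreal s * frac_kernel s x y \<le> frac_kernel s0 x y +
    ennreal (2 * 2 powr (real CARD('n) / 2)) * ennreal (exp ((norm x)\<^sup>2 / 6)) * ennreal (exp ((norm y)\<^sup>2 / 6))"
proof -
  define D where "D = 2 powr (real CARD('n) / 2) * (exp ((norm x)\<^sup>2 / 6) * exp ((norm y)\<^sup>2 / 6))"
  have "ennreal s * frac_kernel s x y \<le>
      ennreal (s * 1 powr (s0 / 2)) * frac_kernel s0 x y + ennreal (2 * D * 1 powr (- (s / 2)))"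
    unfolding frac_kernel_eq_subord
    using assms by (intro subord_upper_bound mehler_nonneg) (auto simp: D_def mehler_le)
  also have "\<dots> \<le> 1 * frac_kernel s0 x y + ennreal (2 * D)"
    using assms by (intro add_mono mult_right_mono) (auto simp: ennreal_le_1)
  also have "ennreal (2 * D) = ennreal (2 * 2 powr (real CARD('n) / 2)) *
      ennreal (exp ((norm x)\<^sup>2 / 6)) * ennreal (exp ((norm y)\<^sup>2 / 6))"
    by (simp add: D_def mult.assoc flip: ennreal_mult)
  finally show ?thesis by simp
qed

text \<open>Finiteness of the interaction of order \<open>s0\<close> plays two roles: it makes \<open>K\<^bsub>s0\<^esub>\<close> finite almost everywhere on
  \<open>A \<times> B\<close>, so that the pointwise limit holds there, and it makes the dominating function integrable.
  Iterated dominated convergence avoids exchanging the order of integration.\<close>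

lemma interaction_tendsto:
  fixes A B :: "(real ^ 'n) set"
  assumes A: "A \<in> sets lebesgue" and B: "B \<in> sets lebesgue" and s0: "0 < s0" "s0 < 1"
    and fin: "(\<integral>\<^sup>+x\<in>A. (\<integral>\<^sup>+y\<in>B. frac_kernel s0 x y \<partial>gauss) \<partial>gauss) < \<infinity>"
  shows "((\<lambda>s. ennreal s * (\<integral>\<^sup>+x\<in>A. (\<integral>\<^sup>+y\<in>B. frac_kernel s x y \<partial>gauss) \<partial>gauss)) \<longlongrightarrow>
           2 * (emeasure gauss A * emeasure gauss B)) (at_right 0)"
proof (rule tendsto_at_right_sequentially[OF s0(1)])
  interpret finite_measure "gauss :: (real ^ 'n) measure" by (rule finite_measure_gauss)
  have [measurable]: "A \<in> sets gauss" "B \<in> sets gauss" using A B by simp_all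
  fix S :: "nat \<Rightarrow> real"
  assume S: "\<And>n. 0 < S n" "\<And>n. S n < s0" and S0: "S \<longlonglongrightarrow> 0"
  have S_right: "filterlim S (at_right 0) sequentially"
    using S S0 by (auto simp: filterlim_at less_imp_neq[symmetric] intro!: always_eventually)
  define C where "C = ennreal (2 * 2 powr (real CARD('n) / 2))"
  define e where "e = (\<lambda>x :: real ^ 'n. ennreal (exp ((norm x)\<^sup>2 / 6)))"
  have [measurable]: "e \<in> borel_measurable borel" unfolding e_def by measurable
  have e_fin: "(\<integral>\<^sup>+x. e x \<partial>gauss) < \<infinity>"
    using nn_integral_gauss_exp_square[of "1 / 6", where 'n = 'n] by (simp add: e_def)
  have e_fin': "(\<integral>\<^sup>+x\<in>X. e x \<partial>gauss) < \<infinity>" for X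
    by (rule le_less_trans[OF _ e_fin]) (auto intro!: nn_integral_mono split: split_indicator)
  have C_fin: "C < \<infinity>" by (simp add: C_def)
  define w where "w = (\<lambda>x y. (frac_kernel s0 x y + C * e x * e y) * indicator B y)"
  define u where "u = (\<lambda>n x y. ennreal (S n) * frac_kernel (S n) x y * indicator B y)"
  have [measurable]: "(\<lambda>p. w (fst p) (snd p)) \<in> borel_measurable (gauss \<Otimes>\<^sub>M gauss)"
    "w x \<in> borel_measurable gauss" for x
    unfolding w_def by measurable
  have [measurable]: "(\<lambda>p. u n (fst p) (snd p)) \<in> borel_measurable (gauss \<Otimes>\<^sub>M gauss)"
    "u n x \<in> borel_measurable gauss" for n x
    unfolding u_def by measurable
  have u_le: "u n x y \<le> w x y" for n x y
    unfolding u_def w_def C_def e_def using S[of n] s0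
    by (intro mult_right_mono frac_kernel_dominated) auto
  have w_int: "(\<integral>\<^sup>+y. w x y \<partial>gauss) =
      (\<integral>\<^sup>+y\<in>B. frac_kernel s0 x y \<partial>gauss) + C * e x * (\<integral>\<^sup>+y\<in>B. e y \<partial>gauss)" for x
    unfolding w_def by (simp add: distrib_right nn_integral_add mult.assoc nn_integral_cmult)
  have inner: "(\<lambda>n. \<integral>\<^sup>+y. u n x y \<partial>gauss) \<longlonglongrightarrow> 2 * emeasure gauss B"
    if K: "(\<integral>\<^sup>+y\<in>B. frac_kernel s0 x y \<partial>gauss) < \<infinity>" for x
  proof -
    have "(\<lambda>n. \<integral>\<^sup>+y. u n x y \<partial>gauss) \<longlonglongrightarrow> (\<integral>\<^sup>+y. 2 * indicator B y \<partial>gauss)"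
    proof (rule nn_integral_dominated_convergence[where w = "w x"])
      show "(\<integral>\<^sup>+y. w x y \<partial>gauss) < \<infinity>"
        using K e_fin'[of B] C_fin by (simp add: w_int ennreal_mult_less_top e_def)
      have "AE y in gauss. frac_kernel s0 x y * indicator B y \<noteq> \<infinity>"
        using K by (intro nn_integral_noteq_infinite) auto
      then show "AE y in gauss. (\<lambda>n. u n x y) \<longlonglongrightarrow> 2 * indicator B y"
      proof eventually_elim
        case (elim y)
        show ?case
        proof (cases "y \<in> B")
          case True
          then have "frac_kernel s0 x y < \<infinity>" using elim by (simp add: less_top)
          from filterlim_compose[OF frac_kernel_tendsto[OF s0(1) this] S_right]
          show ?thesis using True by (simp add: u_def)
        qed (simp add: u_def)
      qed
    qed (auto simp: u_le)
    then show ?thesis using B by (simp add: nn_integral_cmult)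
  qed
  have "(\<lambda>n. \<integral>\<^sup>+x\<in>A. (\<integral>\<^sup>+y. u n x y \<partial>gauss) \<partial>gauss) \<longlonglongrightarrow>
      (\<integral>\<^sup>+x. (2 * emeasure gauss B) * indicator A x \<partial>gauss)"
  proof (rule nn_integral_dominated_convergence[where w = "\<lambda>x. (\<integral>\<^sup>+y. w x y \<partial>gauss) * indicator A x"])
    have "(\<integral>\<^sup>+x. (\<integral>\<^sup>+y. w x y \<partial>gauss) * indicator A x \<partial>gauss) =
        (\<integral>\<^sup>+x. (\<integral>\<^sup>+y\<in>B. frac_kernel s0 x y \<partial>gauss) * indicator A x +
          C * (\<integral>\<^sup>+y\<in>B. e y \<partial>gauss) * (e x * indicator A x) \<partial>gauss)"
      unfolding w_int by (intro nn_integral_cong) (simp add: algebra_simps)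
    also have "\<dots> = (\<integral>\<^sup>+x\<in>A. (\<integral>\<^sup>+y\<in>B. frac_kernel s0 x y \<partial>gauss) \<partial>gauss) +
        C * (\<integral>\<^sup>+y\<in>B. e y \<partial>gauss) * (\<integral>\<^sup>+x\<in>A. e x \<partial>gauss)"
      by (simp add: nn_integral_add nn_integral_cmult)
    also have "\<dots> < \<infinity>"
      using fin e_fin'[of A] e_fin'[of B] C_fin by (simp add: ennreal_mult_less_top)
    finally show "(\<integral>\<^sup>+x. (\<integral>\<^sup>+y. w x y \<partial>gauss) * indicator A x \<partial>gauss) < \<infinity>" .
    have "AE x in gauss. (\<integral>\<^sup>+y\<in>B. frac_kernel s0 x y \<partial>gauss) * indicator A x \<noteq> \<infinity>"
      using fin by (intro nn_integral_noteq_infinite) auto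
    then show "AE x in gauss. (\<lambda>n. (\<integral>\<^sup>+y. u n x y \<partial>gauss) * indicator A x)
        \<longlonglongrightarrow> (2 * emeasure gauss B) * indicator A x"
    proof eventually_elim
      case (elim x)
      then show ?case
        using inner[of x] by (cases "x \<in> A") (auto simp: less_top)
    qed
  qed (auto intro!: nn_integral_mono mult_right_mono u_le)
  moreover have "(\<integral>\<^sup>+x\<in>A. (\<integral>\<^sup>+y. u n x y \<partial>gauss) \<partial>gauss) =
      ennreal (S n) * (\<integral>\<^sup>+x\<in>A. (\<integral>\<^sup>+y\<in>B. frac_kernel (S n) x y \<partial>gauss) \<partial>gauss)" for n
    unfolding u_def by (simp add: mult.assoc nn_integral_cmult)
  moreover have "(\<integral>\<^sup>+x. (2 * emeasure gauss B) * indicator A x \<partial>gauss) =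
      2 * (emeasure gauss A * emeasure gauss B)"
    by (subst nn_integral_cmult_indicator) (use A in \<open>simp_all add: mult_ac\<close>)
  ultimately show "(\<lambda>n. ennreal (S n) * (\<integral>\<^sup>+x\<in>A. (\<integral>\<^sup>+y\<in>B. frac_kernel (S n) x y \<partial>gauss) \<partial>gauss))
      \<longlonglongrightarrow> 2 * (emeasure gauss A * emeasure gauss B)"
    by simp
qed

theorem mainTheorem1:
  fixes \<Omega> E :: "(real ^ 'n) set" and s0 :: real
  assumes "open \<Omega>" and "connected \<Omega>" and "lipschitz_boundary \<Omega>"
    and "E \<in> sets lebesgue"
    and "0 < s0" and "s0 < 1" and "frac_perimeter s0 E \<Omega> < \<infinity>"
  shows "((\<lambda>s. ennreal s * frac_perimeter s E \<Omega>) \<longlongrightarrow>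
           2 * (emeasure gauss E * emeasure gauss (\<Omega> - E) +
                emeasure gauss (E \<inter> \<Omega>) * emeasure gauss ((- E) \<inter> (- \<Omega>)))) (at_right 0)"
proof -
  have \<Omega>: "\<Omega> \<in> sets lebesgue" using \<open>open \<Omega>\<close> by (simp add: sets_completionI_sets)
  have c: "- X \<in> sets lebesgue" if "X \<in> sets lebesgue" for X :: "(real ^ 'n) set"
    using sets.compl_sets[OF that] by (simp add: Compl_eq_Diff_UNIV)
  note m = sets.Int[OF \<open>E \<in> sets lebesgue\<close> \<Omega>] sets.Int[OF c[OF \<open>E \<in> sets lebesgue\<close>] \<Omega>]
    sets.Int[OF \<open>E \<in> sets lebesgue\<close> c[OF \<Omega>]] sets.Int[OF c[OF \<open>E \<in> sets lebesgue\<close>] c[OF \<Omega>]]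
  let ?\<gamma> = "emeasure (gauss :: (real ^ 'n) measure)"
  have "((\<lambda>s. ennreal s * frac_perimeter s E \<Omega>) \<longlongrightarrow>
      2 * (?\<gamma> (E \<inter> \<Omega>) * ?\<gamma> ((- E) \<inter> \<Omega>)) + 2 * (?\<gamma> (E \<inter> \<Omega>) * ?\<gamma> ((- E) \<inter> (- \<Omega>))) +
      2 * (?\<gamma> (E \<inter> (- \<Omega>)) * ?\<gamma> ((- E) \<inter> \<Omega>))) (at_right 0)"
    unfolding frac_perimeter_def distrib_left
    using \<open>frac_perimeter s0 E \<Omega> < \<infinity>\<close> m \<open>0 < s0\<close> \<open>s0 < 1\<close>
    by (intro tendsto_add interaction_tendsto[where ?s0.0 = s0]) (simp_all add: frac_perimeter_def)
  moreover have "?\<gamma> E = ?\<gamma> (E \<inter> \<Omega>) + ?\<gamma> (E \<inter> (- \<Omega>))"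
    using m by (subst plus_emeasure) (auto intro!: arg_cong[where f = ?\<gamma>])
  moreover have "\<Omega> - E = (- E) \<inter> \<Omega>" by auto
  ultimately show ?thesis by (simp add: algebra_simps)
qed

end
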